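(* Consider an instance of the aircraft routing problem with set of flight legs $\mathcal{L}$, number of airplanes $n^{\mathrm{a}}$ and maintenance parameter $\Delta_{\text{maint}}$, and let $D=(V,A)$, with $V=\mathcal{L}\times[\Delta_{\text{maint}}]$, be the associated directed graph. Fix an arbitrary instant in the week, and let $A_0\subseteq A$ be the set of arcs crossing this instant. For $\ell\in\mathcal{L}$ let $V_\ell=\{(\ell,\delta)\in V:\delta\in[\Delta_{\text{maint}}]\}$. Feasible solutions of the aircraft routing problem are in one-to-one correspondence with collections $\mathcal{C}$ of vertex disjoint cycles in $D$ such that we have simultaneously (i) for each $\ell\in\mathcal{L}$, exactly one cycle in $\mathcal{C}$ has a nonempty intersection with $V_\ell$, and this intersection consists of a single vertex; (ii) $\mathcal{C}$ has at most $n^{\mathrm{a}}$ arcs in $A_0$.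
   Context: Aircraft routing problem. The input is a set of airports, some of which are bases (where maintenance checks can be performed), a finite collection $\mathcal{L}$ of flight legs, a number $n^{\mathrm{a}}$ of airplanes, and a positive integer $\Delta_{\text{maint}}$. A flight leg is characterized by departure and arrival airports and departure and arrival times (the departure time being smaller than the arrival time). Times are given for a typical week, which is repeated periodically. An airplane connection is a pair $(\ell,\ell')$ of flight legs such that the arrival airport of $\ell$ is the departure airport of $\ell'$ and the duration between the arrival of $\ell$ and the departure of $\ell'$ is bounded from below by a fixed quantity (which can depend on the airport, the time, and the fleet). There are connections $(\ell,\ell')$ with $\ell$ at the end of the week and $\ell'$ at the beginning of the (next) week. A route is a cyclic sequence of distinct flight legs $\ell_1,\ldots,\ell_k$ such that each pair $(\ell_{i-1},\ell_i)$ and the pair $(\ell_k,\ell_1)$ is an airplane connection. Routes can last several weeks. Each week, the sequences of flight legs operated by the airplanes are the same (the airplanes being considered as indiscernible), so a route lasting $p$ weeks requires $p$ airplanes. A route satisfies the maintenance requirement if an airplane following this route in a cyclic way (repeating it when it reaches the end of the cycle) spends a night in a base at least every $\Delta_{\text{maint}}$ days. A feasible solution of the problem is a partition of $\mathcal{L}$ into routes satisfying the maintenance requirement such that the number of airplanes needed to operate these routes is at most $n^{\mathrm{a}}$. The directed graph $D=(V,A)$. Notation: $[m]=\{1,\ldots,m\}$. The vertex set is $V=\mathcal{L}\times[\Delta_{\text{maint}}]$; a vertex $(\ell,\delta)$ stands for the leg $\ell$ together with the number $\delta$ of days since the last night spent in a base. An ordered pair $((\ell,\delta),(\ell',\delta'))$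 is in $A$ if $(\ell,\ell')$ is an airplane connection and one of the following holds: - $\ell$ and $\ell'$ are performed during a same day and $\delta=\delta'$; - $\ell$ and $\ell'$ are not performed on the same day, the connecting airport (arrival airport of $\ell$) is a base, and $\delta'=1$; - $\ell$ and $\ell'$ are not performed on the same day, the connecting airport is not a base, and $\delta'-\delta\ge 0$ is the number of days between the arrival of $\ell$ and the departure of $\ell'$. An arc $((\ell,\delta),(\ell',\delta'))$ crosses a given instant of the week if the time interval between the departure of $\ell$ (included) and the departure of $\ell'$ (excluded) contains this instant.
   Formalization: Each flight leg is assumed to arrive on the calendar day of its departure, since nights in flight are not counted by the arcs; a connection uses the first weekly departure of the second leg after the departure of the first (at most one week later), with a nonnegative minimum duration. *)

theory Defs
  imports Complex_Main "HOL-Library.Disjoint_Sets" "Graph_Theory.Pair_Digraph"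
begin

text \<open>
  Time is measured in days. The typical week is the interval from 0 (included) to 7 (excluded),
  and the calendar day of an instant is its floor.
\<close>

record 'a leg =
  dep_airport :: 'a
  arr_airport :: 'a
  dep_time :: real
  arr_time :: real

text \<open>
  The value of \<open>min_turn I a s t\<close> is the minimal duration of a connection at airport \<open>a\<close> between
  an arrival at time \<open>s\<close> and a departure at time \<open>t\<close> of the typical week.
\<close>

record 'a routing_input =
  airports :: "'a set"
  bases :: "'a set"
  legs :: "'a leg set"
  n_airplanes :: nat
  maint_days :: nat
  min_turn :: "'a \<Rightarrow> real \<Rightarrow> real \<Rightarrow> real"

text \<open>
  Requiring that a leg arrives on the day of its departure gives a meaning to ``two legs are
  performed during a same day''. Without it, a night may be spent in flight, and such a
  night is not counted by the arcs of the digraph below.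
\<close>

definition routing_instance :: "'a routing_input \<Rightarrow> bool" where
  "routing_instance I \<longleftrightarrow>
     bases I \<subseteq> airports I \<and>
     finite (legs I) \<and>
     (\<forall>l \<in> legs I. dep_airport l \<in> airports I \<and> arr_airport l \<in> airports I \<and>
        0 \<le> dep_time l \<and> dep_time l < 7 \<and>
        dep_time l < arr_time l \<and> \<lfloor>arr_time l\<rfloor> = \<lfloor>dep_time l\<rfloor>) \<and>
     0 < maint_days I \<and>
     (\<forall>a s t. 0 \<le> min_turn I a s t)"


subsection \<open>Connections\<close>

text \<open>
  Since the week is repeated periodically, the leg following \<open>l\<close> is operated in its first
  occurrence departing strictly after the departure of \<open>l\<close>. The duration \<open>elapsed l l'\<close> between the
  two departures is thus positive and at most one week; it is one week when \<open>l' = l\<close>.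
\<close>

definition elapsed :: "'a leg \<Rightarrow> 'a leg \<Rightarrow> real" where
  "elapsed l l' =
     (if dep_time l < dep_time l' then dep_time l' - dep_time l
      else dep_time l' + 7 - dep_time l)"

definition connection :: "'a routing_input \<Rightarrow> 'a leg \<Rightarrow> 'a leg \<Rightarrow> bool" where
  "connection I l l' \<longleftrightarrow>
     l \<in> legs I \<and> l' \<in> legs I \<and>
     arr_airport l = dep_airport l' \<and>
     (dep_time l + elapsed l l') - arr_time l
       \<ge> min_turn I (arr_airport l) (arr_time l) (dep_time l')"

definition same_day :: "'a leg \<Rightarrow> 'a leg \<Rightarrow> bool" where
  "same_day l l' \<longleftrightarrow> \<lfloor>dep_time l + elapsed l l'\<rfloor> = \<lfloor>dep_time l\<rfloor>"

definition days_between :: "'a leg \<Rightarrow> 'a leg \<Rightarrow> int" where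
  "days_between l l' = \<lfloor>dep_time l + elapsed l l'\<rfloor> - \<lfloor>arr_time l\<rfloor>"


subsection \<open>Cyclic sequences\<close>

text \<open>A cyclic sequence is represented by the set of all lists obtained by choosing a first element.\<close>

definition cyclic_seq :: "'b list \<Rightarrow> 'b list set" where
  "cyclic_seq xs = {rotate n xs | n. True}"

text \<open>The pairs of consecutive elements, including the pair of the last and the first one.\<close>

definition cyclic_pairs :: "'b list \<Rightarrow> ('b \<times> 'b) set" where
  "cyclic_pairs xs = set (zip xs (rotate1 xs))"


subsection \<open>Routes and feasible solutions\<close>

definition route :: "'a routing_input \<Rightarrow> 'a leg list set \<Rightarrow> bool" where
  "route I r \<longleftrightarrow>
     (\<exists>ls. r = cyclic_seq ls \<and> ls \<noteq> [] \<and> distinct ls \<and> set ls \<subseteq> legs I \<and>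
        (\<forall>(l, l') \<in> cyclic_pairs ls. connection I l l'))"

definition route_legs :: "'a leg list set \<Rightarrow> 'a leg set" where
  "route_legs r = (\<Union>ls \<in> r. set ls)"

definition route_weeks :: "'a leg list set \<Rightarrow> real" where
  "route_weeks r = (\<Sum>(l, l') \<in> (\<Union>ls \<in> r. cyclic_pairs ls). elapsed l l') / 7"

text \<open>
  Times at which an airplane repeating \<open>ls\<close> forever, starting with the first leg in week 0, departs
  on and arrives from its \<open>j\<close>-th leg (counted from 0).
\<close>

definition departure :: "'a leg list \<Rightarrow> nat \<Rightarrow> real" where
  "departure ls j =
     dep_time (ls ! 0) +
     (\<Sum>i<j. elapsed (ls ! (i mod length ls)) (ls ! (Suc i mod length ls)))"

definition arrival :: "'a leg list \<Rightarrow> nat \<Rightarrow> real" where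
  "arrival ls j =
     departure ls j + (arr_time (ls ! (j mod length ls)) - dep_time (ls ! (j mod length ls)))"

text \<open>Night \<open>n\<close> is the one between the days \<open>n\<close> and \<open>n + 1\<close>.\<close>

definition night_in_base :: "'a routing_input \<Rightarrow> 'a leg list \<Rightarrow> int \<Rightarrow> bool" where
  "night_in_base I ls n \<longleftrightarrow>
     (\<exists>j. arr_airport (ls ! (j mod length ls)) \<in> bases I \<and>
        \<lfloor>arrival ls j\<rfloor> \<le> n \<and> n < \<lfloor>departure ls (Suc j)\<rfloor>)"

text \<open>
  Among any \<open>maint_days I\<close> consecutive nights, one is spent in a base. Equivalently, two consecutive
  nights in a base are at most \<open>maint_days I\<close> days apart.
\<close>

definition maintained :: "'a routing_input \<Rightarrow> 'a leg list set \<Rightarrow> bool" where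
  "maintained I r \<longleftrightarrow>
     (\<forall>ls \<in> r. \<forall>m \<ge> \<lfloor>dep_time (ls ! 0)\<rfloor>.
        \<exists>n \<in> {m ..< m + int (maint_days I)}. night_in_base I ls n)"

definition feasible_solution :: "'a routing_input \<Rightarrow> 'a leg list set set \<Rightarrow> bool" where
  "feasible_solution I S \<longleftrightarrow>
     (\<forall>r \<in> S. route I r \<and> maintained I r) \<and>
     disjoint_family_on route_legs S \<and> (\<Union>r \<in> S. route_legs r) = legs I \<and>
     (\<Sum>r \<in> S. route_weeks r) \<le> real (n_airplanes I)"


subsection \<open>The digraph\<close>

type_synonym 'a vertex = "'a leg \<times> nat"

definition vertices :: "'a routing_input \<Rightarrow> 'a vertex set" where
  "vertices I = legs I \<times> {1..maint_days I}"

definition routing_arcs :: "'a routing_input \<Rightarrow> ('a vertex \<times> 'a vertex) set" where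
  "routing_arcs I =
     {((l, d), (l', d')) | l d l' d'.
        (l, d) \<in> vertices I \<and> (l', d') \<in> vertices I \<and> connection I l l' \<and>
        (same_day l l' \<and> d = d' \<or>
         \<not> same_day l l' \<and> arr_airport l \<in> bases I \<and> d' = 1 \<or>
         \<not> same_day l l' \<and> arr_airport l \<notin> bases I \<and>
           d \<le> d' \<and> int d' - int d = days_between l l')}"

definition routing_digraph :: "'a routing_input \<Rightarrow> 'a vertex pair_pre_digraph" where
  "routing_digraph I = \<lparr>pverts = vertices I, parcs = routing_arcs I\<rparr>"

text \<open>The arcs crossing the instant \<open>t\<close> of the week, which recurs at \<open>t + 7 * k\<close> for all \<open>k\<close>.\<close>

definition crossing_arcs :: "'a routing_input \<Rightarrow> real \<Rightarrow> ('a vertex \<times> 'a vertex) set" where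
  "crossing_arcs I t =
     {((l, d), (l', d')) | l d l' d'.
        ((l, d), (l', d')) \<in> routing_arcs I \<and>
        (\<exists>k::int. dep_time l \<le> t + 7 * of_int k \<and>
           t + 7 * of_int k < dep_time l + elapsed l l')}"

definition leg_vertices :: "'a routing_input \<Rightarrow> 'a leg \<Rightarrow> 'a vertex set" where
  "leg_vertices I l = {(l, d) | d. (l, d) \<in> vertices I}"

text \<open>A cycle of the library is a closed arc walk; its starting vertex is forgotten here.\<close>

definition digraph_cycle :: "'b pair_pre_digraph \<Rightarrow> ('b \<times> 'b) list set \<Rightarrow> bool" where
  "digraph_cycle G c \<longleftrightarrow> (\<exists>p. pre_digraph.cycle (with_proj G) p \<and> c = cyclic_seq p)"

definition cycle_arcs :: "('b \<times> 'b) list set \<Rightarrow> ('b \<times> 'b) set" where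
  "cycle_arcs c = (\<Union>p \<in> c. set p)"

definition cycle_vertices :: "('b \<times> 'b) list set \<Rightarrow> 'b set" where
  "cycle_vertices c = fst ` cycle_arcs c"

text \<open>
  The cyclic sequence of legs visited by a cycle: each arc \<open>((l, d), (l', d'))\<close> contributes \<open>l\<close>.
\<close>

definition cycle_leg_seq :: "('a vertex \<times> 'a vertex) list set \<Rightarrow> 'a leg list set" where
  "cycle_leg_seq c = map (\<lambda>e. fst (fst e)) ` c"

end

theory Submission
  imports Defs
begin

text \<open>
  A cycle of the digraph that meets every \<open>leg_vertices I l\<close> at most once amounts to a route with a
  value \<open>\<delta> l\<close> of the day counter on each of its legs (\<open>lifted_cycle_iff\<close>). Along an arc, the new value
  of the counter is a function \<open>next_count\<close> of the old one: it is kept during a day, reset to 1 after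
  a night in a base, and increased by the number of days after any other night. Hence everything
  rests on the question which routes carry a counter with values in \<open>{1..maint_days I}\<close>, and how
  many.

  Existence. Unroll the route into the infinite sequence of legs operated by one airplane. On the
  \<open>k\<close>-th day after its last night in a base, the airplane has counter \<open>k\<close>. So the counter
  stays at most \<open>maint_days I\<close> iff no \<open>maint_days I\<close> consecutive nights avoid the bases, which is
  the maintenance requirement (\<open>bounded_counter_imp_reset\<close>, \<open>reset_imp_bounded_counter\<close> and
  \<open>day_counter_iff_maintained\<close>).

  Uniqueness. A night in a base does occur on a route that carries a counter, since otherwise the
  counter would grow forever. It sets the counter to 1 whatever the previous value, and the remaining
  values follow by recursion (\<open>day_counter_unique\<close>).

  Thus \<open>cycle_leg_seq\<close> is a bijection from these cycles to the maintained routes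
  (\<open>bij_betw_cycle_leg_seq\<close>). On collections, condition (i) together with vertex disjointness says
  that the legs of the cycles partition \<open>legs I\<close> (\<open>leg_partition_iff\<close>). For the airplanes, measure
  each departure relative to the fixed instant: the duration of an arc is the change of this phase,
  plus one week if the arc crosses the instant. The phases cancel around a cycle, so a route lasts as
  many weeks as its cycle has crossing arcs (\<open>card_crossing_arcs\<close>).
\<close>

section \<open>Cyclic sequences and cycles\<close>

lemma zip_rotate:
  assumes "length xs = length ys"
  shows "zip (rotate n xs) (rotate n ys) = rotate n (zip xs ys)"
  by (rule nth_equalityI) (use assms in \<open>auto simp: nth_rotate intro!: nth_zip[symmetric] mod_less_divisor\<close>)

lemma cyclic_pairs_rotate [simp]: "cyclic_pairs (rotate n xs) = cyclic_pairs xs"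
proof -
  have "zip (rotate n xs) (rotate1 (rotate n xs)) = rotate n (zip xs (rotate1 xs))"
    by (simp add: rotate1_rotate_swap zip_rotate)
  then show ?thesis
    by (simp add: cyclic_pairs_def)
qed

lemma cyclic_pairs_conv_nth:
  "cyclic_pairs xs = {(xs ! i, xs ! (Suc i mod length xs)) | i. i < length xs}"
  by (auto simp: cyclic_pairs_def set_zip nth_rotate1)

lemma cyclic_pairs_map: "cyclic_pairs (map f xs) = map_prod f f ` cyclic_pairs xs"
  by (simp add: cyclic_pairs_def rotate1_map zip_map_map map_prod_def)

lemma cyclic_pairs_subset: "cyclic_pairs xs \<subseteq> set xs \<times> set xs"
  by (auto simp: cyclic_pairs_def dest: set_zip_leftD set_zip_rightD)

lemma fst_cyclic_pairs: "fst ` cyclic_pairs xs = set xs"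
  by (simp add: cyclic_pairs_def flip: set_map)

lemma self_in_cyclic_seq: "xs \<in> cyclic_seq xs"
  unfolding cyclic_seq_def by (metis (mono_tags, lifting) CollectI id_apply rotate0)

lemma cyclic_seq_rotate [simp]: "cyclic_seq (rotate n xs) = cyclic_seq xs"
proof -
  have "rotate m xs \<in> cyclic_seq (rotate n xs)" for m
  proof (cases "xs = []")
    case False
    then have "n \<le> n * length xs"
      by (cases xs) auto
    then have "n \<le> m + n * length xs"
      by linarith
    then have "rotate (m + n * length xs - n) (rotate n xs) = rotate (m + n * length xs) xs"
      by (simp add: rotate_rotate)
    also have "\<dots> = rotate m xs"
      using rotate_conv_mod[of "m + n * length xs" xs] rotate_conv_mod[of m xs] by simp
    finally show ?thesis
      unfolding cyclic_seq_def by (metis (mono_tags, lifting) CollectI)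
  qed (simp add: cyclic_seq_def)
  then show ?thesis
    by (auto simp: cyclic_seq_def rotate_rotate)
qed

lemma cyclic_seq_map: "map f ` cyclic_seq xs = cyclic_seq (map f xs)"
  by (auto simp: cyclic_seq_def rotate_map)

lemma pcas_iff: "pcas u p v \<longleftrightarrow> map fst p @ [v] = u # map snd p"
  by (induction p arbitrary: u) auto

lemma pawalk_verts_eq: "pcas u p v \<Longrightarrow> pawalk_verts u p = u # map snd p"
  by (induction p arbitrary: u) auto

text \<open>
  A cycle is determined by its list of tails: in a closed walk, the list of heads is the list of
  tails rotated by one position, so the condition that the heads are distinct is a condition on the
  tails.
\<close>

lemma digraph_cycle_iff:
  assumes "parcs G \<subseteq> pverts G \<times> pverts G"
  shows "digraph_cycle G c \<longleftrightarrow>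
    (\<exists>vs. vs \<noteq> [] \<and> distinct vs \<and> cyclic_pairs vs \<subseteq> parcs G \<and> c = cyclic_seq (zip vs (rotate1 vs)))"
proof -
  have "pre_digraph.cycle (with_proj G) p \<longleftrightarrow>
    (\<exists>vs. vs \<noteq> [] \<and> distinct vs \<and> cyclic_pairs vs \<subseteq> parcs G \<and> p = zip vs (rotate1 vs))"
    (is "?cycle \<longleftrightarrow> ?list") for p
  proof
    assume ?cycle
    then obtain u where u: "p \<noteq> []" "set p \<subseteq> parcs G" "pcas u p u" "distinct (map snd p)"
      unfolding pre_digraph.cycle_def pre_digraph.awalk_def
      by (auto simp: cas_with_proj_eq awalk_verts_with_proj_eq pawalk_verts_eq)
    then have snd_p: "map snd p = rotate1 (map fst p)"
      by (cases p) (auto simp: pcas_iff)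
    then have "p = zip (map fst p) (rotate1 (map fst p))"
      by (metis zip_map_fst_snd)
    moreover have "distinct (map fst p)"
      using u snd_p by (metis distinct1_rotate)
    ultimately show ?list
      using u by (metis cyclic_pairs_def map_is_Nil_conv)
  next
    assume ?list
    then obtain vs where vs: "vs \<noteq> []" "distinct vs" "cyclic_pairs vs \<subseteq> parcs G"
      "p = zip vs (rotate1 vs)"
      by blast
    define u where "u = hd vs"
    have maps: "map fst p = vs" "map snd p = rotate1 vs"
      using vs by auto
    have "pcas u p u"
      using vs maps by (cases vs) (auto simp: pcas_iff u_def)
    moreover have "u \<in> pverts G"
      using vs assms fst_cyclic_pairs[of vs] unfolding u_def by (cases vs) fastforce+
    ultimately show ?cycle
      unfolding pre_digraph.cycle_def pre_digraph.awalk_def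
      using vs maps
      by (intro exI[of _ u])
        (auto simp: cas_with_proj_eq awalk_verts_with_proj_eq pawalk_verts_eq cyclic_pairs_def)
  qed
  then show ?thesis
    unfolding digraph_cycle_def by metis
qed

section \<open>The day counter along a route\<close>

text \<open>
  The three alternatives for an arc leave no choice for the counter at its head. As \<open>days_between\<close> is
  nonnegative, its truncation to a natural number loses nothing.
\<close>

definition next_count :: "'a routing_input \<Rightarrow> 'a leg \<Rightarrow> 'a leg \<Rightarrow> nat \<Rightarrow> nat" where
  "next_count I l l' d =
     (if same_day l l' then d
      else if arr_airport l \<in> bases I then 1
      else d + nat (days_between l l'))"

lemma elapsed_pos:
  assumes "routing_instance I" "l \<in> legs I" "l' \<in> legs I"
  shows "0 < elapsed l l'"
proof -
  have "dep_time l < 7" "0 \<le> dep_time l'"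
    using assms by (auto simp: routing_instance_def)
  then show ?thesis
    by (simp add: elapsed_def)
qed

lemma days_between_conv:
  assumes "routing_instance I" "l \<in> legs I"
  shows "days_between l l' = \<lfloor>dep_time l + elapsed l l'\<rfloor> - \<lfloor>dep_time l\<rfloor>"
  using assms by (auto simp: days_between_def routing_instance_def)

lemma days_between_nonneg:
  assumes "routing_instance I" "l \<in> legs I" "l' \<in> legs I"
  shows "0 \<le> days_between l l'"
  using elapsed_pos[OF assms] by (simp add: days_between_conv[OF assms(1,2)] floor_mono)

lemma routing_arcs_iff:
  assumes "routing_instance I"
  shows "((l, d), (l', d')) \<in> routing_arcs I \<longleftrightarrow>
    connection I l l' \<and> d \<in> {1..maint_days I} \<and> d' \<in> {1..maint_days I} \<and> d' = next_count I l l' d"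
proof (cases "connection I l l'")
  case True
  then have "0 \<le> days_between l l'"
    using assms days_between_nonneg by (auto simp: connection_def)
  then show ?thesis
    using True
    by (auto simp: routing_arcs_def vertices_def connection_def next_count_def)
qed (auto simp: routing_arcs_def)

text \<open>
  A route is a rotation class of such lists. Working with one list and rotating it when convenient is
  harmless because \<open>route_list\<close>, \<open>day_counter\<close> and \<open>lifted_cycle\<close> are invariant under rotation.
\<close>

definition route_list :: "'a routing_input \<Rightarrow> 'a leg list \<Rightarrow> bool" where
  "route_list I ls \<longleftrightarrow> ls \<noteq> [] \<and> distinct ls \<and> set ls \<subseteq> legs I \<and>
     (\<forall>(l, l') \<in> cyclic_pairs ls. connection I l l')"

definition day_counter :: "'a routing_input \<Rightarrow> 'a leg list \<Rightarrow> ('a leg \<Rightarrow> nat) \<Rightarrow> bool" where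
  "day_counter I ls \<delta> \<longleftrightarrow> \<delta> ` set ls \<subseteq> {1..maint_days I} \<and>
     (\<forall>(l, l') \<in> cyclic_pairs ls. \<delta> l' = next_count I l l' (\<delta> l))"

definition lifted_cycle :: "'a leg list \<Rightarrow> ('a leg \<Rightarrow> nat) \<Rightarrow> ('a vertex \<times> 'a vertex) list set" where
  "lifted_cycle ls \<delta> = cyclic_seq (map (\<lambda>(l, l'). ((l, \<delta> l), (l', \<delta> l'))) (zip ls (rotate1 ls)))"

lemma route_list_rotate [simp]: "route_list I (rotate n ls) = route_list I ls"
  by (simp add: route_list_def)

lemma day_counter_rotate [simp]: "day_counter I (rotate n ls) \<delta> = day_counter I ls \<delta>"
  by (simp add: day_counter_def)

lemma lifted_cycle_rotate [simp]: "lifted_cycle (rotate n ls) \<delta> = lifted_cycle ls \<delta>"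
  by (simp add: lifted_cycle_def rotate1_rotate_swap zip_rotate flip: rotate_map)

lemma lifted_cycle_cong:
  assumes "\<And>l. l \<in> set ls \<Longrightarrow> \<delta> l = \<delta>' l"
  shows "lifted_cycle ls \<delta> = lifted_cycle ls \<delta>'"
proof -
  have "map (\<lambda>(l, l'). ((l, \<delta> l), (l', \<delta> l'))) (zip ls (rotate1 ls)) =
        map (\<lambda>(l, l'). ((l, \<delta>' l), (l', \<delta>' l'))) (zip ls (rotate1 ls))"
    using assms by (intro map_cong) (auto dest: set_zip_leftD set_zip_rightD)
  then show ?thesis
    unfolding lifted_cycle_def by (rule arg_cong)
qed

lemma cycle_arcs_cyclic_seq: "cycle_arcs (cyclic_seq p) = set p"
  using self_in_cyclic_seq[of p] by (auto simp: cycle_arcs_def cyclic_seq_def)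

lemma cycle_arcs_lifted_cycle:
  "cycle_arcs (lifted_cycle ls \<delta>) = (\<lambda>(l, l'). ((l, \<delta> l), (l', \<delta> l'))) ` cyclic_pairs ls"
  by (simp add: lifted_cycle_def cycle_arcs_cyclic_seq cyclic_pairs_def)

lemma cycle_vertices_lifted_cycle:
  "cycle_vertices (lifted_cycle ls \<delta>) = (\<lambda>l. (l, \<delta> l)) ` set ls"
proof -
  have "cycle_vertices (lifted_cycle ls \<delta>) = (\<lambda>l. (l, \<delta> l)) ` fst ` cyclic_pairs ls"
    by (auto simp: cycle_vertices_def cycle_arcs_lifted_cycle image_image case_prod_beta)
  then show ?thesis
    by (simp add: fst_cyclic_pairs)
qed

lemma cycle_leg_seq_lifted_cycle: "cycle_leg_seq (lifted_cycle ls \<delta>) = cyclic_seq ls"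
  by (simp add: cycle_leg_seq_def lifted_cycle_def cyclic_seq_map comp_def case_prod_beta)

lemma route_legs_cycle_leg_seq: "route_legs (cycle_leg_seq c) = fst ` cycle_vertices c"
  by (simp add: route_legs_def cycle_leg_seq_def cycle_vertices_def cycle_arcs_def
      image_image image_UN)

text \<open>
  Visiting each leg at most once makes the second components of the vertices a function of the
  legs.
\<close>

lemma lifted_cycle_iff:
  assumes "routing_instance I"
  shows "digraph_cycle (routing_digraph I) c \<and> inj_on fst (cycle_vertices c) \<longleftrightarrow>
    (\<exists>ls \<delta>. route_list I ls \<and> day_counter I ls \<delta> \<and> c = lifted_cycle ls \<delta>)"
    (is "?cycle \<longleftrightarrow> ?lift")
proof -
  have arcs: "parcs (routing_digraph I) \<subseteq> pverts (routing_digraph I) \<times> pverts (routing_digraph I)"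
    by (auto simp: routing_digraph_def routing_arcs_def)
  have cyclic_arcs: "zip vs (rotate1 vs) = map (\<lambda>(l, l'). ((l, \<delta> l), (l', \<delta> l'))) (zip ls (rotate1 ls))"
    if "vs = map (\<lambda>l. (l, \<delta> l)) ls" for vs ls and \<delta> :: "'a leg \<Rightarrow> nat"
    unfolding that by (simp add: rotate1_map zip_map_map)
  have arcs_iff: "cyclic_pairs (map (\<lambda>l. (l, \<delta> l)) ls) \<subseteq> routing_arcs I \<longleftrightarrow>
      set ls \<subseteq> legs I \<and> (\<forall>(l, l') \<in> cyclic_pairs ls. connection I l l') \<and> day_counter I ls \<delta>"
    (is "?A \<longleftrightarrow> ?B") for ls \<delta>
  proof -
    have "?A \<longleftrightarrow> (\<forall>(l, l') \<in> cyclic_pairs ls. connection I l l' \<and> \<delta> l \<in> {1..maint_days I} \<and>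
      \<delta> l' \<in> {1..maint_days I} \<and> \<delta> l' = next_count I l l' (\<delta> l))"
      by (auto simp: cyclic_pairs_map routing_arcs_iff[OF assms] map_prod_def)
    also have "\<dots> \<longleftrightarrow> (\<forall>l \<in> set ls. l \<in> legs I \<and> \<delta> l \<in> {1..maint_days I}) \<and>
       (\<forall>(l, l') \<in> cyclic_pairs ls. connection I l l' \<and> \<delta> l' = next_count I l l' (\<delta> l))"
      using cyclic_pairs_subset[of ls]
      by (auto simp: connection_def simp flip: fst_cyclic_pairs)
    also have "\<dots> \<longleftrightarrow> ?B"
      by (auto simp: day_counter_def)
    finally show ?thesis .
  qed
  show ?thesis
  proof
    assume ?cycle
    then obtain vs where vs: "vs \<noteq> []" "distinct vs" "cyclic_pairs vs \<subseteq> routing_arcs I"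
      "c = cyclic_seq (zip vs (rotate1 vs))" "inj_on fst (cycle_vertices c)"
      unfolding digraph_cycle_iff[OF arcs] by (auto simp: routing_digraph_def)
    have "cycle_vertices c = set vs"
      by (simp add: vs(4) cycle_vertices_def cycle_arcs_cyclic_seq flip: set_map)
    with vs have inj: "inj_on fst (set vs)"
      by simp
    define ls where "ls = map fst vs"
    define \<delta> where "\<delta> l = snd (the_inv_into (set vs) fst l)" for l
    have vs_eq: "vs = map (\<lambda>l. (l, \<delta> l)) ls"
      using inj by (auto simp: ls_def \<delta>_def the_inv_into_f_f intro!: nth_equalityI)
    have "route_list I ls" "day_counter I ls \<delta>"
      using arcs_iff[of \<delta> ls] vs inj unfolding vs_eq[symmetric]
      by (auto simp: route_list_def ls_def distinct_map)
    moreover have "c = lifted_cycle ls \<delta>"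
      by (simp add: vs(4) lifted_cycle_def cyclic_arcs[OF vs_eq])
    ultimately show ?lift
      by blast
  next
    assume ?lift
    then obtain ls \<delta> where ls: "route_list I ls" "day_counter I ls \<delta>" "c = lifted_cycle ls \<delta>"
      by blast
    define vs where "vs = map (\<lambda>l. (l, \<delta> l)) ls"
    have "vs \<noteq> []" "distinct vs" "cyclic_pairs vs \<subseteq> routing_arcs I"
      using ls arcs_iff[of \<delta> ls] by (auto simp: route_list_def vs_def distinct_map inj_on_def)
    moreover have "c = cyclic_seq (zip vs (rotate1 vs))"
      by (simp add: ls(3) lifted_cycle_def cyclic_arcs[OF vs_def])
    moreover have "inj_on fst (cycle_vertices c)"
      by (auto simp: ls(3) cycle_vertices_lifted_cycle inj_on_def)
    ultimately show ?cycle
      unfolding digraph_cycle_iff[OF arcs] by (auto simp: routing_digraph_def)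
  qed
qed

section \<open>Counting the days since the last reset\<close>

text \<open>
  Here \<open>T j\<close> is the day of the \<open>j\<close>-th departure and \<open>reset j\<close> says that the stop after the \<open>j\<close>-th leg
  is in a base. Were there no reset during \<open>D\<close> nights, the counter would increase with the days by at
  least \<open>D\<close>, starting from at least 1, and exceed \<open>D\<close>.
\<close>

lemma bounded_counter_imp_reset:
  fixes T :: "nat \<Rightarrow> int" and d :: "nat \<Rightarrow> nat"
  assumes "mono T" and unbounded: "\<And>m. \<exists>j. m < T j"
    and step: "\<And>j. d (Suc j) =
      (if T (Suc j) = T j then d j else if reset j then 1 else d j + nat (T (Suc j) - T j))"
    and bounded: "\<And>j. d j \<in> {1..D}"
    and "T 0 \<le> m"
  shows "\<exists>n \<in> {m ..< m + int D}. \<exists>j. reset j \<and> T j \<le> n \<and> n < T (Suc j)"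
proof (rule ccontr)
  assume no_reset: "\<not> ?thesis"
  \<comment> \<open>\<open>first x\<close> is the first departure after day \<open>x\<close>; the night \<open>m\<close> falls between \<open>j\<close> and \<open>Suc j\<close>.\<close>
  define first where "first x = (LEAST j. x < T j)" for x
  have first: "x < T (first x)" for x
    unfolding first_def by (rule LeastI_ex) (rule unbounded)
  have before_first: "T j \<le> x" if "j < first x" for j x
    using not_less_Least[of j "\<lambda>j. x < T j"] that by (simp add: first_def)
  have "0 < D"
    using bounded[of 0] by auto
  obtain j where j: "first m = Suc j"
    using first[of m] \<open>T 0 \<le> m\<close> by (cases "first m") auto
  have Tj: "T j \<le> m"
    using before_first[of j m] j by simp
  define i\<^sub>1 where "i\<^sub>1 = first (m + int D - 1)"
  have Ti\<^sub>1: "m + int D \<le> T i\<^sub>1"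
    using first[of "m + int D - 1"] by (simp add: i\<^sub>1_def)
  have "j < i\<^sub>1"
    using Tj Ti\<^sub>1 \<open>0 < D\<close> monoD[OF \<open>mono T\<close>, of i\<^sub>1 j] by (cases "j < i\<^sub>1") auto
  have "int (d i) = int (d j) + T i - T j" if "i \<le> i\<^sub>1" "j \<le> i" for i
    using that(2,1)
  proof (induction i rule: dec_induct)
    case (step i)
    have "T i \<le> T (Suc i)"
      using \<open>mono T\<close> by (simp add: monoD)
    moreover have "T (Suc i) = T i \<or> \<not> reset i"
    proof (rule ccontr)
      assume contr: "\<not> (T (Suc i) = T i \<or> \<not> reset i)"
      have "m < T (Suc i)"
        using first[of m] j step(1) monoD[OF \<open>mono T\<close>, of "Suc j" "Suc i"] by simp
      moreover have "T i < m + int D"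
        using before_first[of i "m + int D - 1"] step(4) by (simp add: i\<^sub>1_def)
      \<comment> \<open>A stop may begin before \<open>m\<close>, so take the first of its nights that is not before \<open>m\<close>.\<close>
      ultimately have "max (T i) m \<in> {m ..< m + int D}" "max (T i) m < T (Suc i)"
        using contr \<open>T i \<le> T (Suc i)\<close> \<open>0 < D\<close> by auto
      then show False
        using no_reset contr by (meson max.cobounded1)
    qed
    ultimately show ?case
      using step(3,4) assms(3)[of i] by auto
  qed simp
  from this[of i\<^sub>1] have "int (d i\<^sub>1) = int (d j) + T i\<^sub>1 - T j"
    using \<open>j < i\<^sub>1\<close> by simp
  then show False
    using Tj Ti\<^sub>1 bounded[of j] bounded[of i\<^sub>1] by auto
qed

text \<open>
  Conversely, if the counter starts at 1, it always equals 1 plus the number of days since its last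
  reset (or since the start). No night in between is spent in a base, so fewer than \<open>D\<close> days have
  passed.
\<close>

lemma reset_imp_bounded_counter:
  fixes T :: "nat \<Rightarrow> int" and d :: "nat \<Rightarrow> nat"
  assumes "mono T"
    and "d 0 = 1"
    and step: "\<And>j. d (Suc j) =
      (if T (Suc j) = T j then d j else if reset j then 1 else d j + nat (T (Suc j) - T j))"
    and resets: "\<And>m. T 0 \<le> m \<Longrightarrow>
      \<exists>n \<in> {m ..< m + int D}. \<exists>j. reset j \<and> T j \<le> n \<and> n < T (Suc j)"
  shows "d j \<in> {1..D}"
proof -
  have "\<exists>i\<le>j. int (d j) = 1 + T j - T i \<and> (\<forall>i'. i \<le> i' \<and> i' < j \<and> reset i' \<longrightarrow> T (Suc i') = T i')"
  proof (induction j)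
    case (Suc j)
    then obtain i where i: "i \<le> j" "int (d j) = 1 + T j - T i"
      "\<forall>i'. i \<le> i' \<and> i' < j \<and> reset i' \<longrightarrow> T (Suc i') = T i'"
      by blast
    have le: "T j \<le> T (Suc j)"
      using \<open>mono T\<close> by (simp add: monoD)
    show ?case
    proof (cases "reset j \<and> T (Suc j) \<noteq> T j")
      case True
      then show ?thesis
        using step[of j] by (intro exI[of _ "Suc j"]) auto
    next
      case False
      then have "int (d (Suc j)) = 1 + T (Suc j) - T i"
        using step[of j] i(2) le by auto
      then show ?thesis
        using i False by (intro exI[of _ i]) (auto simp: less_Suc_eq)
    qed
  qed (use \<open>d 0 = 1\<close> in auto)
  then obtain i where i: "i \<le> j" "int (d j) = 1 + T j - T i"
    "\<forall>i'. i \<le> i' \<and> i' < j \<and> reset i' \<longrightarrow> T (Suc i') = T i'"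
    by blast
  have "T 0 \<le> T i" "T i \<le> T j"
    using \<open>mono T\<close> i(1) by (simp_all add: monoD)
  then obtain n i' where n: "T i \<le> n" "n < T i + int D" "reset i'" "T i' \<le> n" "n < T (Suc i')"
    using resets[of "T i"] by auto
  have "\<not> T i + int D \<le> T j"
  proof
    assume "T i + int D \<le> T j"
    then have "T i' < T j" "T i < T (Suc i')"
      using n by auto
    then have "i' < j" "i < Suc i'"
      using \<open>mono T\<close> by (meson linorder_not_le monoD)+
    then show False
      using i(3) n by auto
  qed
  then show ?thesis
    using i(2) \<open>T i \<le> T j\<close> by auto
qed

section \<open>The day counter and the maintenance requirement\<close>

abbreviation leg_at :: "'a leg list \<Rightarrow> nat \<Rightarrow> 'a leg" where
  "leg_at ls j \<equiv> ls ! (j mod length ls)"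

abbreviation departure_day :: "'a leg list \<Rightarrow> nat \<Rightarrow> int" where
  "departure_day ls j \<equiv> \<lfloor>departure ls j\<rfloor>"

lemma departure_0: "departure ls 0 = dep_time (ls ! 0)"
  by (simp add: departure_def)

lemma departure_Suc:
  "departure ls (Suc j) = departure ls j + elapsed (leg_at ls j) (leg_at ls (Suc j))"
  by (simp add: departure_def)

text \<open>
  The \<open>j\<close>-th departure takes place at its weekly time in some week, so that unrolling a
  route in time keeps the day differences of the typical week.
\<close>

lemma departure_mod_week: "\<exists>w::int. departure ls j = dep_time (leg_at ls j) + 7 * of_int w"
proof (induction j)
  case 0
  show ?case
    by (rule exI[of _ 0]) (simp add: departure_0)
next
  case (Suc j)
  then obtain w :: int where w: "departure ls j = dep_time (leg_at ls j) + 7 * of_int w"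
    by blast
  show ?case
  proof (cases "dep_time (leg_at ls j) < dep_time (leg_at ls (Suc j))")
    case True
    then show ?thesis
      by (intro exI[of _ w]) (simp add: departure_Suc w elapsed_def)
  next
    case False
    then show ?thesis
      by (intro exI[of _ "w + 1"]) (simp add: departure_Suc w elapsed_def)
  qed
qed

context
  fixes I :: "'a routing_input" and ls :: "'a leg list"
  assumes inst: "routing_instance I" and route_list: "route_list I ls"
begin

lemma leg_at_in_legs: "leg_at ls j \<in> legs I"
  using route_list by (auto simp: route_list_def)

lemma leg_at_cyclic_pairs: "(leg_at ls j, leg_at ls (Suc j)) \<in> cyclic_pairs ls"
proof -
  have "j mod length ls < length ls"
    using route_list by (simp add: route_list_def)
  moreover have "Suc j mod length ls = Suc (j mod length ls) mod length ls"
    by (simp add: mod_Suc_eq)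
  ultimately show ?thesis
    unfolding cyclic_pairs_conv_nth by auto
qed

lemma departure_day_Suc:
  "departure_day ls (Suc j) = departure_day ls j + days_between (leg_at ls j) (leg_at ls (Suc j))"
proof -
  obtain w :: int where w: "departure ls j = dep_time (leg_at ls j) + of_int (7 * w)"
    using departure_mod_week[of ls j] by auto
  have "departure ls (Suc j) =
      dep_time (leg_at ls j) + elapsed (leg_at ls j) (leg_at ls (Suc j)) + of_int (7 * w)"
    by (simp add: departure_Suc w)
  then show ?thesis
    by (simp only: w days_between_conv[OF inst leg_at_in_legs] floor_add_int[symmetric])
qed

lemma same_day_iff:
  "same_day (leg_at ls j) (leg_at ls (Suc j)) \<longleftrightarrow> departure_day ls (Suc j) = departure_day ls j"
  by (simp add: departure_day_Suc same_day_def days_between_conv[OF inst leg_at_in_legs])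

lemma arrival_day: "\<lfloor>arrival ls j\<rfloor> = departure_day ls j"
proof -
  obtain w :: int where w: "departure ls j = dep_time (leg_at ls j) + of_int (7 * w)"
    using departure_mod_week[of ls j] by auto
  then have "arrival ls j = arr_time (leg_at ls j) + of_int (7 * w)"
    by (simp add: arrival_def)
  moreover have "\<lfloor>arr_time (leg_at ls j)\<rfloor> = \<lfloor>dep_time (leg_at ls j)\<rfloor>"
    using inst leg_at_in_legs[of j] by (simp add: routing_instance_def)
  ultimately show ?thesis
    by (simp only: w floor_add_int[symmetric])
qed

lemma departure_day_mono: "mono (departure_day ls)"
proof (rule mono_iff_le_Suc[THEN iffD2], rule allI)
  show "departure_day ls j \<le> departure_day ls (Suc j)" for j
    using days_between_nonneg[OF inst leg_at_in_legs leg_at_in_legs, of j "Suc j"]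
    by (simp add: departure_day_Suc)
qed

text \<open>
  Only finitely many connections occur, so the positive durations between consecutive departures are
  bounded away from 0.
\<close>

lemma departure_day_unbounded: "\<exists>j. m < departure_day ls j"
proof -
  define gap where "gap = Min ((\<lambda>(l, l'). elapsed l l') ` cyclic_pairs ls)"
  have pairs: "finite (cyclic_pairs ls)" "cyclic_pairs ls \<noteq> {}"
    using leg_at_cyclic_pairs by (auto simp: cyclic_pairs_def)
  have "0 < elapsed l l'" if "(l, l') \<in> cyclic_pairs ls" for l l'
    using that cyclic_pairs_subset[of ls] route_list elapsed_pos[OF inst]
    by (auto simp: route_list_def)
  then have "0 < gap"
    unfolding gap_def using pairs by (subst Min_gr_iff) auto
  have gap_le: "gap \<le> elapsed (leg_at ls j) (leg_at ls (Suc j))" for j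
    unfolding gap_def using pairs leg_at_cyclic_pairs[of j] by (intro Min_le) force+
  have lower: "departure ls 0 + of_nat j * gap \<le> departure ls j" for j
  proof (induction j)
    case (Suc j)
    then show ?case
      using gap_le[of j] by (simp add: departure_Suc algebra_simps)
  qed simp
  obtain j :: nat where "of_int (m + 1) - departure ls 0 < of_nat j * gap"
    using reals_Archimedean3[OF \<open>0 < gap\<close>] by blast
  then have "of_int (m + 1) \<le> departure ls j"
    using lower[of j] by linarith
  then have "m + 1 \<le> departure_day ls j"
    by (simp only: le_floor_iff)
  then show ?thesis
    by (intro exI[of _ j]) simp
qed

lemma next_count_departure_day:
  "next_count I (leg_at ls j) (leg_at ls (Suc j)) d =
     (if departure_day ls (Suc j) = departure_day ls j then d
      else if arr_airport (leg_at ls j) \<in> bases I then 1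
      else d + nat (departure_day ls (Suc j) - departure_day ls j))"
  by (simp add: next_count_def same_day_iff) (simp add: departure_day_Suc)

lemma night_in_base_iff:
  "night_in_base I ls n \<longleftrightarrow>
     (\<exists>j. arr_airport (leg_at ls j) \<in> bases I \<and> departure_day ls j \<le> n \<and> n < departure_day ls (Suc j))"
  by (simp add: night_in_base_def arrival_day)

lemma day_counter_imp_night_in_base:
  assumes "day_counter I ls \<delta>" and "departure_day ls 0 \<le> m"
  shows "\<exists>n \<in> {m ..< m + int (maint_days I)}. night_in_base I ls n"
  unfolding night_in_base_iff
proof (rule bounded_counter_imp_reset[where d = "\<lambda>j. \<delta> (leg_at ls j)"])
  show "\<delta> (leg_at ls (Suc j)) =
      (if departure_day ls (Suc j) = departure_day ls j then \<delta> (leg_at ls j)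
       else if arr_airport (leg_at ls j) \<in> bases I then 1
       else \<delta> (leg_at ls j) + nat (departure_day ls (Suc j) - departure_day ls j))" for j
    using assms(1) leg_at_cyclic_pairs[of j]
    unfolding next_count_departure_day[symmetric] day_counter_def by blast
  show "\<delta> (leg_at ls j) \<in> {1..maint_days I}" for j
  proof -
    have "leg_at ls j \<in> set ls"
      using route_list by (simp add: route_list_def)
    then show ?thesis
      using assms(1) unfolding day_counter_def by blast
  qed
qed (use departure_day_mono departure_day_unbounded assms(2) in auto)

text \<open>
  Assume that the list is cut at a night in a base; this is the meaning of a constant \<open>next_count\<close>
  from the last leg to the first. Then running the recursion once through the list from the value 1 is
  consistent with the connection that closes the route.
\<close>

lemma day_counter_exists:
  assumes last_night: "next_count I (last ls) (hd ls) = (\<lambda>_. 1)"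
    and maint: "maintained I (cyclic_seq ls)"
  shows "\<exists>\<delta>. day_counter I ls \<delta>"
proof -
  have ne: "ls \<noteq> []" and dist: "distinct ls"
    using route_list by (auto simp: route_list_def)
  \<comment> \<open>The counter is computed on the unrolled route, where the bound is available; the indices below
    the length of the list define it on the legs.\<close>
  define d where "d = rec_nat 1 (\<lambda>j. next_count I (leg_at ls j) (leg_at ls (Suc j)))"
  have d_0: "d 0 = 1" and d_Suc: "d (Suc j) = next_count I (leg_at ls j) (leg_at ls (Suc j)) (d j)" for j
    by (simp_all add: d_def)
  have d_bound: "d j \<in> {1..maint_days I}" for j
  proof (rule reset_imp_bounded_counter[where d = d and T = "departure_day ls" and
        reset = "\<lambda>j. arr_airport (leg_at ls j) \<in> bases I", OF departure_day_mono d_0])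
    show "\<exists>n \<in> {m ..< m + int (maint_days I)}. \<exists>j. arr_airport (leg_at ls j) \<in> bases I \<and>
        departure_day ls j \<le> n \<and> n < departure_day ls (Suc j)" if "departure_day ls 0 \<le> m" for m
      using maint that self_in_cyclic_seq[of ls]
      unfolding maintained_def night_in_base_iff[symmetric] by (simp add: departure_0)
  qed (simp only: d_Suc next_count_departure_day)
  define \<delta> where "\<delta> l = d (the_inv_into {..<length ls} ((!) ls) l)" for l
  have \<delta>: "\<delta> (ls ! i) = d i" if "i < length ls" for i
    using that dist by (simp add: \<delta>_def the_inv_into_f_f inj_on_nth)
  have "\<delta> (ls ! (Suc i mod length ls)) =
      next_count I (ls ! i) (ls ! (Suc i mod length ls)) (\<delta> (ls ! i))" if i: "i < length ls" for i
  proof (cases "Suc i < length ls")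
    case True
    then show ?thesis
      using d_Suc[of i] by (simp add: \<delta>)
  next
    case False
    then have "i = length ls - 1" "Suc i mod length ls = 0"
      using i by (auto simp: not_less_eq less_Suc_eq)
    then show ?thesis
      using ne last_night by (simp add: \<delta> d_0 last_conv_nth hd_conv_nth)
  qed
  then have "day_counter I ls \<delta>"
    using d_bound by (auto simp: day_counter_def cyclic_pairs_conv_nth in_set_conv_nth \<delta>)
  then show ?thesis
    by blast
qed

text \<open>
  The closing connection forces the value 1 at the first leg, and the recursion forces the
  others.
\<close>

lemma day_counter_unique:
  assumes last_night: "next_count I (last ls) (hd ls) = (\<lambda>_. 1)"
    and counters: "day_counter I ls \<delta>" "day_counter I ls \<delta>'"
    and l: "l \<in> set ls"
  shows "\<delta> l = \<delta>' l"
proof -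
  have ne: "ls \<noteq> []"
    using route_list by (auto simp: route_list_def)
  have step: "\<delta> (leg_at ls (Suc j)) = next_count I (leg_at ls j) (leg_at ls (Suc j)) (\<delta> (leg_at ls j))"
    if "day_counter I ls \<delta>" for \<delta> j
    using that leg_at_cyclic_pairs[of j] unfolding day_counter_def by blast
  \<comment> \<open>The index \<open>length ls - 1\<close> is that of the last leg, whose successor is the first leg.\<close>
  have first: "\<delta> (leg_at ls 0) = 1" if "day_counter I ls \<delta>" for \<delta>
    using step[OF that, of "length ls - 1"] ne last_night
    by (simp add: last_conv_nth hd_conv_nth)
  have "\<delta> (leg_at ls j) = \<delta>' (leg_at ls j)" for j
    by (induction j) (simp_all only: first[OF counters(1)] first[OF counters(2)]
        step[OF counters(1)] step[OF counters(2)])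
  moreover obtain j where "j < length ls" "l = ls ! j"
    using l by (auto simp: in_set_conv_nth)
  ultimately show ?thesis
    by (metis mod_less)
qed

end

text \<open>
  Cutting the route at a night in a base provides the hypothesis of the two preceding lemmas.
\<close>

lemma rotate_to_base_night:
  assumes "routing_instance I" "route_list I ls" "night_in_base I ls n"
  obtains k where "next_count I (last (rotate k ls)) (hd (rotate k ls)) = (\<lambda>_. 1)"
proof -
  obtain j where j: "arr_airport (leg_at ls j) \<in> bases I"
    "departure_day ls j \<le> n" "n < departure_day ls (Suc j)"
    using assms night_in_base_iff by blast
  then have reset: "next_count I (leg_at ls j) (leg_at ls (Suc j)) = (\<lambda>_. 1)"
    by (auto simp: next_count_departure_day[OF assms(1,2)])
  have ne: "ls \<noteq> []"
    using assms(2) by (simp add: route_list_def)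
  have "hd (rotate (Suc j) ls) = leg_at ls (Suc j)"
    by (rule hd_rotate_conv_nth[OF ne])
  moreover have "last (rotate (Suc j) ls) = leg_at ls j"
  proof -
    have "last (rotate (Suc j) ls) = ls ! ((Suc j + (length ls - 1)) mod length ls)"
      using ne by (simp add: last_conv_nth nth_rotate del: rotate_Suc)
    also have "Suc j + (length ls - 1) = j + length ls"
      using ne by (cases ls) auto
    finally show ?thesis
      by simp
  qed
  ultimately show ?thesis
    using reset that by metis
qed

lemma day_counter_iff_maintained:
  assumes "routing_instance I" "route_list I ls"
  shows "(\<exists>\<delta>. day_counter I ls \<delta>) \<longleftrightarrow> maintained I (cyclic_seq ls)"
proof
  assume "\<exists>\<delta>. day_counter I ls \<delta>"
  then obtain \<delta> where "day_counter I ls \<delta>" ..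
  then show "maintained I (cyclic_seq ls)"
    using assms day_counter_imp_night_in_base[OF assms(1), of "rotate n ls" \<delta> for n]
    by (auto simp: maintained_def cyclic_seq_def departure_0)
next
  assume maint: "maintained I (cyclic_seq ls)"
  then obtain n where "night_in_base I ls n"
    using self_in_cyclic_seq[of ls] unfolding maintained_def by blast
  then obtain k where k: "next_count I (last (rotate k ls)) (hd (rotate k ls)) = (\<lambda>_. 1)"
    using assms by (rule_tac rotate_to_base_night)
  then show "\<exists>\<delta>. day_counter I ls \<delta>"
    using day_counter_exists[OF assms(1) _ k] assms(2) maint by simp
qed

lemma lifted_cycle_unique:
  assumes "routing_instance I" "route_list I ls" "day_counter I ls \<delta>" "day_counter I ls \<delta>'"
  shows "lifted_cycle ls \<delta> = lifted_cycle ls \<delta>'"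
proof -
  obtain n where "night_in_base I ls n"
    using day_counter_imp_night_in_base[OF assms(1,2,3) order_refl] by blast
  then obtain k where k: "next_count I (last (rotate k ls)) (hd (rotate k ls)) = (\<lambda>_. 1)"
    using assms(1,2) by (rule_tac rotate_to_base_night)
  have "\<delta> l = \<delta>' l" if "l \<in> set ls" for l
    using day_counter_unique[OF assms(1) _ k] assms that by simp
  then show ?thesis
    by (rule lifted_cycle_cong)
qed

section \<open>Airplanes and crossing arcs\<close>

text \<open>
  Shift each departure by whole weeks into the week that ends at \<open>t\<close> (included). An arc leaving from
  such a \<open>phase\<close> lasts at most one week, so it crosses \<open>t\<close> iff the departure at its
  head then falls in the next week. Hence \<open>elapsed\<close> is the change of phase plus 7 times the indicator of
  crossing, and the changes of phase sum to 0 around the route.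
\<close>

lemma card_crossing_arcs:
  assumes "routing_instance I" "route_list I ls" "day_counter I ls \<delta>" "0 \<le> t" "t < 7"
  shows "real (card (cycle_arcs (lifted_cycle ls \<delta>) \<inter> crossing_arcs I t)) =
    route_weeks (cyclic_seq ls)"
proof -
  define crosses where "crosses l l' \<longleftrightarrow>
    (\<exists>k::int. dep_time l \<le> t + 7 * of_int k \<and> t + 7 * of_int k < dep_time l + elapsed l l')"
    for l l' :: "'a leg"
  define phase where "phase l = (if dep_time l \<le> t then dep_time l else dep_time l - 7)"
    for l :: "'a leg"
  have legs: "0 \<le> dep_time l" "dep_time l < 7" if "l \<in> set ls" for l
    using that assms by (auto simp: routing_instance_def route_list_def)
  have elapsed: "elapsed l l' = phase l' - phase l + 7 * of_bool (crosses l l')"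
    if "l \<in> set ls" "l' \<in> set ls" for l l'
  proof -
    define s :: int where "s = of_bool (t < dep_time l)"
    have s: "phase l = dep_time l - 7 * of_int s" "phase l \<le> t" "t < phase l + 7"
      using legs[OF that(1)] assms(4,5) by (auto simp: phase_def s_def)
    have e: "0 < elapsed l l'" "elapsed l l' \<le> 7"
      using legs[OF that(1)] legs[OF that(2)] by (auto simp: elapsed_def)
    have "crosses l l' \<longleftrightarrow> t < phase l + elapsed l l'"
    proof
      assume "crosses l l'"
      then obtain k :: int where "dep_time l \<le> t + 7 * of_int k"
        "t + 7 * of_int k < dep_time l + elapsed l l'"
        unfolding crosses_def by blast
      moreover define x :: real where "x = of_int (k - s)"
      ultimately have x: "phase l \<le> t + 7 * x" "t + 7 * x < phase l + elapsed l l'"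
        by (simp_all add: s(1))
      then have "of_int (- 1) < x"
        using s(3) by simp
      then have "0 \<le> x"
        unfolding x_def of_int_less_iff of_int_0_le_iff by simp
      then show "t < phase l + elapsed l l'"
        using x(2) by linarith
    next
      assume "t < phase l + elapsed l l'"
      then show "crosses l l'"
        unfolding crosses_def using s by (intro exI[of _ s]) (auto simp: algebra_simps)
    qed
    then show ?thesis
      using legs[OF that(1)] legs[OF that(2)] assms(4,5)
      by (auto simp: phase_def elapsed_def split: if_splits)
  qed
  have dist: "distinct ls"
    using assms(2) by (simp add: route_list_def)
  have sum_pairs: "sum f (cyclic_pairs ls) = sum_list (map f (zip ls (rotate1 ls)))"
    for f :: "_ \<Rightarrow> real"
    using dist by (simp add: cyclic_pairs_def sum_list_distinct_conv_sum_set distinct_zipI1)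
  have "(\<Sum>(l, l') \<in> cyclic_pairs ls. phase l' - phase l) =
      (\<Sum>p \<in> cyclic_pairs ls. phase (snd p)) - (\<Sum>p \<in> cyclic_pairs ls. phase (fst p))"
    by (simp add: sum_subtractf case_prod_beta)
  also have "\<dots> = sum_list (map phase (map snd (zip ls (rotate1 ls)))) -
      sum_list (map phase (map fst (zip ls (rotate1 ls))))"
    unfolding sum_pairs map_map comp_def ..
  also have "\<dots> = 0"
    using dist by (simp add: sum_list_distinct_conv_sum_set)
  finally have telescope: "(\<Sum>(l, l') \<in> cyclic_pairs ls. phase l' - phase l) = 0" .
  define crossing where "crossing = {p \<in> cyclic_pairs ls. crosses (fst p) (snd p)}"
  have fin: "finite (cyclic_pairs ls)"
    by (simp add: cyclic_pairs_def)
  have "(\<Sum>(l, l') \<in> cyclic_pairs ls. elapsed l l') =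
      (\<Sum>(l, l') \<in> cyclic_pairs ls. phase l' - phase l + 7 * of_bool (crosses l l'))"
    using cyclic_pairs_subset[of ls] by (intro sum.cong) (auto simp: elapsed)
  also have "\<dots> = (\<Sum>(l, l') \<in> cyclic_pairs ls. phase l' - phase l) +
      7 * (\<Sum>(l, l') \<in> cyclic_pairs ls. of_bool (crosses l l'))"
    by (simp add: sum.distrib case_prod_beta sum_distrib_left)
  also have "\<dots> = 7 * card crossing"
    unfolding telescope
    by (simp add: crossing_def case_prod_beta fin sum.If_cases Int_def of_bool_def)
  finally have weeks: "(\<Sum>(l, l') \<in> cyclic_pairs ls. elapsed l l') =
      7 * card crossing" .
  have "cycle_arcs (lifted_cycle ls \<delta>) \<inter> crossing_arcs I t =
      (\<lambda>(l, l'). ((l, \<delta> l), (l', \<delta> l'))) ` crossing"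
  proof -
    have "((l, \<delta> l), (l', \<delta> l')) \<in> routing_arcs I" if "(l, l') \<in> cyclic_pairs ls" for l l'
      using that assms(2,3) cyclic_pairs_subset[of ls]
      unfolding routing_arcs_iff[OF assms(1)] route_list_def day_counter_def by blast
    then show ?thesis
      by (auto simp: cycle_arcs_lifted_cycle crossing_arcs_def crosses_def crossing_def
          intro!: rev_image_eqI)
  qed
  then have "card (cycle_arcs (lifted_cycle ls \<delta>) \<inter> crossing_arcs I t) =
      card crossing"
    by (simp add: card_image inj_on_def case_prod_beta prod_eq_iff)
  moreover have "(\<Union>ls' \<in> cyclic_seq ls. cyclic_pairs ls') = cyclic_pairs ls"
    by (auto simp: cyclic_seq_def)
  ultimately show ?thesis
    by (simp add: route_weeks_def weeks)
qed

section \<open>The correspondence\<close>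

lemma route_iff: "route I r \<longleftrightarrow> (\<exists>ls. route_list I ls \<and> r = cyclic_seq ls)"
  by (auto simp: route_def route_list_def)

text \<open>
  Surjectivity is the existence of the counter, injectivity its uniqueness: two cycles with the same
  image come from lists that are rotations of each other, hence from two counters on a same list.
\<close>

lemma bij_betw_cycle_leg_seq:
  assumes "routing_instance I"
  shows "bij_betw cycle_leg_seq
    {c. digraph_cycle (routing_digraph I) c \<and> inj_on fst (cycle_vertices c)}
    {r. route I r \<and> maintained I r}"
    (is "bij_betw _ ?K ?R")
proof -
  have K: "c \<in> ?K \<longleftrightarrow> (\<exists>ls \<delta>. route_list I ls \<and> day_counter I ls \<delta> \<and> c = lifted_cycle ls \<delta>)" for c
    using lifted_cycle_iff[OF assms, of c] by simp
  have R: "r \<in> ?R \<longleftrightarrow> (\<exists>ls \<delta>. route_list I ls \<and> day_counter I ls \<delta> \<and> r = cyclic_seq ls)" for r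
    using day_counter_iff_maintained[OF assms] by (auto simp: route_iff)
  show ?thesis
    unfolding bij_betw_def
  proof
    show "inj_on cycle_leg_seq ?K"
    proof (rule inj_onI)
      fix c c' assume "c \<in> ?K" "c' \<in> ?K" and same: "cycle_leg_seq c = cycle_leg_seq c'"
      then obtain ls \<delta> ls' \<delta>' where
        c: "route_list I ls" "day_counter I ls \<delta>" "c = lifted_cycle ls \<delta>" and
        c': "route_list I ls'" "day_counter I ls' \<delta>'" "c' = lifted_cycle ls' \<delta>'"
        unfolding K by blast
      have "ls' \<in> cyclic_seq ls"
        using same self_in_cyclic_seq[of ls'] by (simp add: c(3) c'(3) cycle_leg_seq_lifted_cycle)
      then obtain n where "ls' = rotate n ls"
        by (auto simp: cyclic_seq_def)
      then have "day_counter I ls \<delta>'" "c' = lifted_cycle ls \<delta>'"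
        using c' by simp_all
      then show "c = c'"
        using lifted_cycle_unique[OF assms c(1,2)] c(3) by simp
    qed
    show "cycle_leg_seq ` ?K = ?R"
    proof (rule set_eqI)
      show "r \<in> cycle_leg_seq ` ?K \<longleftrightarrow> r \<in> ?R" for r
        unfolding image_iff Bex_def K R using cycle_leg_seq_lifted_cycle by metis
    qed
  qed
qed

lemma card_crossing_arcs_cycle:
  assumes "routing_instance I" "0 \<le> t" "t < 7"
    and "digraph_cycle (routing_digraph I) c" "inj_on fst (cycle_vertices c)"
  shows "real (card (cycle_arcs c \<inter> crossing_arcs I t)) = route_weeks (cycle_leg_seq c)"
proof -
  obtain ls \<delta> where "route_list I ls" "day_counter I ls \<delta>" "c = lifted_cycle ls \<delta>"
    using assms lifted_cycle_iff[OF assms(1)] by blast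
  then show ?thesis
    using card_crossing_arcs[OF assms(1) _ _ assms(2,3)] by (simp add: cycle_leg_seq_lifted_cycle)
qed

lemma digraph_cycle_finite_nonempty:
  assumes "digraph_cycle G c"
  shows "finite (cycle_arcs c)" "cycle_arcs c \<noteq> {}" "cycle_arcs c \<subseteq> parcs G"
  using assms
  by (auto simp: digraph_cycle_def cycle_arcs_cyclic_seq pre_digraph.cycle_def pre_digraph.awalk_def)

lemma cycle_vertices_subset:
  assumes "digraph_cycle (routing_digraph I) c"
  shows "cycle_vertices c \<subseteq> vertices I"
  using digraph_cycle_finite_nonempty(3)[OF assms]
  by (fastforce simp: cycle_vertices_def routing_digraph_def routing_arcs_def)

text \<open>
  The vertices in \<open>leg_vertices I l\<close> are those with first component \<open>l\<close>, so condition (i) speaks only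
  about the first components: each leg occurs in one set \<open>V c\<close>, and only once in it. Disjointness of
  the leg sets is stronger than vertex disjointness.
\<close>

lemma leg_partition_iff:
  assumes "\<And>c. c \<in> \<C> \<Longrightarrow> V c \<subseteq> vertices I"
  shows "disjoint_family_on V \<C> \<and>
      (\<forall>l \<in> legs I. (\<exists>!c. c \<in> \<C> \<and> V c \<inter> leg_vertices I l \<noteq> {}) \<and>
        (\<forall>c \<in> \<C>. V c \<inter> leg_vertices I l \<noteq> {} \<longrightarrow> card (V c \<inter> leg_vertices I l) = 1)) \<longleftrightarrow>
    (\<forall>c \<in> \<C>. inj_on fst (V c)) \<and> disjoint_family_on (\<lambda>c. fst ` V c) \<C> \<and>
      (\<Union>c \<in> \<C>. fst ` V c) = legs I"
    (is "?L \<longleftrightarrow> ?R")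
proof -
  have slice: "V c \<inter> leg_vertices I l = {v \<in> V c. fst v = l}" if "c \<in> \<C>" for c l
    using assms[OF that] by (auto simp: leg_vertices_def)
  have meets: "V c \<inter> leg_vertices I l \<noteq> {} \<longleftrightarrow> l \<in> fst ` V c" if "c \<in> \<C>" for c l
    unfolding slice[OF that] by force
  have legs: "l \<in> legs I" if "c \<in> \<C>" "l \<in> fst ` V c" for c l
    using assms[OF that(1)] that(2) by (auto simp: vertices_def)
  have single: "(\<forall>l \<in> legs I. l \<in> fst ` V c \<longrightarrow> card (V c \<inter> leg_vertices I l) = 1) \<longleftrightarrow>
      inj_on fst (V c)" if c: "c \<in> \<C>" for c
  proof
    assume one: "\<forall>l \<in> legs I. l \<in> fst ` V c \<longrightarrow> card (V c \<inter> leg_vertices I l) = 1"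
    show "inj_on fst (V c)"
    proof (rule inj_onI)
      fix v w assume vw: "v \<in> V c" "w \<in> V c" "fst v = fst w"
      then have "card {u \<in> V c. fst u = fst v} = 1"
        using one legs[OF c] by (auto simp flip: slice[OF c])
      then obtain u where "{u \<in> V c. fst u = fst v} = {u}"
        by (auto simp: card_1_singleton_iff)
      then have "v = u" "w = u"
        using vw by force+
      then show "v = w"
        by simp
    qed
  next
    assume inj: "inj_on fst (V c)"
    show "\<forall>l \<in> legs I. l \<in> fst ` V c \<longrightarrow> card (V c \<inter> leg_vertices I l) = 1"
    proof (intro ballI impI)
      fix l assume "l \<in> fst ` V c"
      then obtain v where "v \<in> V c" "l = fst v"
        by blast
      then have "V c \<inter> leg_vertices I l = {v}"
        using inj by (auto simp: slice[OF c] inj_on_def)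
      then show "card (V c \<inter> leg_vertices I l) = 1"
        by simp
    qed
  qed
  have "?L \<longleftrightarrow> disjoint_family_on V \<C> \<and> (\<forall>l \<in> legs I. \<exists>!c. c \<in> \<C> \<and> l \<in> fst ` V c) \<and>
      (\<forall>c \<in> \<C>. inj_on fst (V c))"
    using meets single by (smt (verit, best))
  also have "(\<forall>l \<in> legs I. \<exists>!c. c \<in> \<C> \<and> l \<in> fst ` V c) \<longleftrightarrow>
      disjoint_family_on (\<lambda>c. fst ` V c) \<C> \<and> (\<Union>c \<in> \<C>. fst ` V c) = legs I"
  proof
    assume unique: "\<forall>l \<in> legs I. \<exists>!c. c \<in> \<C> \<and> l \<in> fst ` V c"
    have "fst ` V c \<inter> fst ` V c' = {}" if "c \<in> \<C>" "c' \<in> \<C>" "c \<noteq> c'" for c c'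
      using unique that legs by blast
    moreover have "(\<Union>c \<in> \<C>. fst ` V c) = legs I"
    proof
      show "(\<Union>c \<in> \<C>. fst ` V c) \<subseteq> legs I"
        using legs by (intro UN_least subsetI)
      show "legs I \<subseteq> (\<Union>c \<in> \<C>. fst ` V c)"
      proof
        fix l assume "l \<in> legs I"
        with unique obtain c where "c \<in> \<C>" "l \<in> fst ` V c"
          by metis
        then show "l \<in> (\<Union>c \<in> \<C>. fst ` V c)"
          by (rule UN_I)
      qed
    qed
    ultimately show "disjoint_family_on (\<lambda>c. fst ` V c) \<C> \<and> (\<Union>c \<in> \<C>. fst ` V c) = legs I"
      by (simp add: disjoint_family_on_def)
  next
    assume partition: "disjoint_family_on (\<lambda>c. fst ` V c) \<C> \<and> (\<Union>c \<in> \<C>. fst ` V c) = legs I"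
    show "\<forall>l \<in> legs I. \<exists>!c. c \<in> \<C> \<and> l \<in> fst ` V c"
    proof
      fix l assume "l \<in> legs I"
      with partition obtain c where c: "c \<in> \<C>" "l \<in> fst ` V c"
        by (metis UN_E)
      moreover have "c' = c" if "c' \<in> \<C>" "l \<in> fst ` V c'" for c'
        using partition c that disjoint_iff[of "fst ` V c" "fst ` V c'"]
        unfolding disjoint_family_on_def by metis
      ultimately show "\<exists>!c. c \<in> \<C> \<and> l \<in> fst ` V c"
        by metis
    qed
  qed
  finally have eq: "?L \<longleftrightarrow> disjoint_family_on V \<C> \<and>
      (disjoint_family_on (\<lambda>c. fst ` V c) \<C> \<and> (\<Union>c \<in> \<C>. fst ` V c) = legs I) \<and>
      (\<forall>c \<in> \<C>. inj_on fst (V c))" .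
  have "disjoint_family_on V \<C>" if "disjoint_family_on (\<lambda>c. fst ` V c) \<C>"
    using that unfolding disjoint_family_on_def by blast
  then show ?thesis
    unfolding eq by argo
qed

text \<open>
  Cycles without common legs have no common arcs, so the crossing arcs can be counted cycle by
  cycle. There are finitely many cycles, as a nonempty set of arcs belongs to at most one of
  them.
\<close>

lemma card_crossing_arcs_collection:
  assumes "routing_instance I" "0 \<le> t" "t < 7"
    and cycles: "\<And>c. c \<in> \<C> \<Longrightarrow> digraph_cycle (routing_digraph I) c \<and> inj_on fst (cycle_vertices c)"
    and disj: "disjoint_family_on (\<lambda>c. fst ` cycle_vertices c) \<C>"
  shows "real (card ((\<Union>c \<in> \<C>. cycle_arcs c) \<inter> crossing_arcs I t)) =
    (\<Sum>c \<in> \<C>. route_weeks (cycle_leg_seq c))"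
proof -
  have disj_arcs: "cycle_arcs c \<inter> cycle_arcs c' = {}" if "c \<in> \<C>" "c' \<in> \<C>" "c \<noteq> c'" for c c'
    using disj that unfolding disjoint_family_on_def cycle_vertices_def by blast
  have "finite \<C>"
  proof (rule inj_on_finite)
    show "inj_on cycle_arcs \<C>"
      using disj_arcs cycles digraph_cycle_finite_nonempty(2) by (metis inf.idem inj_onI)
    show "cycle_arcs ` \<C> \<subseteq> Pow (vertices I \<times> vertices I)"
      using cycles digraph_cycle_finite_nonempty(3)
      by (fastforce simp: routing_digraph_def routing_arcs_def)
    show "finite (Pow (vertices I \<times> vertices I))"
      using assms(1) by (simp add: routing_instance_def vertices_def)
  qed
  have "(\<Union>c \<in> \<C>. cycle_arcs c) \<inter> crossing_arcs I t = (\<Union>c \<in> \<C>. cycle_arcs c \<inter> crossing_arcs I t)"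
    by blast
  also have "card \<dots> = (\<Sum>c \<in> \<C>. card (cycle_arcs c \<inter> crossing_arcs I t))"
    using \<open>finite \<C>\<close> cycles digraph_cycle_finite_nonempty(1) disj_arcs
    by (intro card_UN_disjoint) blast+
  also have "real \<dots> = (\<Sum>c \<in> \<C>. route_weeks (cycle_leg_seq c))"
    using cycles card_crossing_arcs_cycle[OF assms(1-3)] by simp
  finally show ?thesis .
qed

theorem proposition1:
  fixes I :: "'a routing_input" and t :: real
  assumes "routing_instance I"
    and "0 \<le> t" and "t < 7"
  shows "bij_betw (\<lambda>\<C>. cycle_leg_seq ` \<C>)
    {\<C>. (\<forall>c \<in> \<C>. digraph_cycle (routing_digraph I) c) \<and>
         disjoint_family_on cycle_vertices \<C> \<and>
         (\<forall>l \<in> legs I.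
            (\<exists>!c. c \<in> \<C> \<and> cycle_vertices c \<inter> leg_vertices I l \<noteq> {}) \<and>
            (\<forall>c \<in> \<C>. cycle_vertices c \<inter> leg_vertices I l \<noteq> {} \<longrightarrow>
               card (cycle_vertices c \<inter> leg_vertices I l) = 1)) \<and>
         card ((\<Union>c \<in> \<C>. cycle_arcs c) \<inter> crossing_arcs I t) \<le> n_airplanes I}
    {S. feasible_solution I S}"
    (is "bij_betw _ ?L _")
proof -
  let ?K = "{c. digraph_cycle (routing_digraph I) c \<and> inj_on fst (cycle_vertices c)}"
  let ?R = "{r. route I r \<and> maintained I r}"
  let ?cover = "\<lambda>\<C>. disjoint_family_on (\<lambda>c. fst ` cycle_vertices c) \<C> \<and>
    (\<Union>c \<in> \<C>. fst ` cycle_vertices c) = legs I"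
  let ?weeks = "\<lambda>\<C>. (\<Sum>c \<in> \<C>. route_weeks (cycle_leg_seq c)) \<le> real (n_airplanes I)"
  let ?partition = "\<lambda>S. disjoint_family_on route_legs S \<and> (\<Union>r \<in> S. route_legs r) = legs I \<and>
    (\<Sum>r \<in> S. route_weeks r) \<le> real (n_airplanes I)"
  note bij = bij_betw_cycle_leg_seq[OF assms(1)]
  have weeks: "card ((\<Union>c \<in> \<C>. cycle_arcs c) \<inter> crossing_arcs I t) \<le> n_airplanes I \<longleftrightarrow> ?weeks \<C>"
    if "\<C> \<subseteq> ?K" "?cover \<C>" for \<C>
  proof -
    have "real (card ((\<Union>c \<in> \<C>. cycle_arcs c) \<inter> crossing_arcs I t)) =
        (\<Sum>c \<in> \<C>. route_weeks (cycle_leg_seq c))"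
      using that by (intro card_crossing_arcs_collection assms) auto
    then show ?thesis
      by (simp flip: of_nat_le_iff[where 'a = real])
  qed
  have L: "?L = {\<C> \<in> Pow ?K. ?cover \<C> \<and> ?weeks \<C>}"
  proof (rule Collect_cong)
    fix \<C>
    show "((\<forall>c \<in> \<C>. digraph_cycle (routing_digraph I) c) \<and>
         disjoint_family_on cycle_vertices \<C> \<and>
         (\<forall>l \<in> legs I.
            (\<exists>!c. c \<in> \<C> \<and> cycle_vertices c \<inter> leg_vertices I l \<noteq> {}) \<and>
            (\<forall>c \<in> \<C>. cycle_vertices c \<inter> leg_vertices I l \<noteq> {} \<longrightarrow>
               card (cycle_vertices c \<inter> leg_vertices I l) = 1)) \<and>
         card ((\<Union>c \<in> \<C>. cycle_arcs c) \<inter> crossing_arcs I t) \<le> n_airplanes I) \<longleftrightarrow>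
       (\<C> \<in> Pow ?K \<and> ?cover \<C> \<and> ?weeks \<C>)"
    proof (cases "\<forall>c \<in> \<C>. digraph_cycle (routing_digraph I) c")
      case True
      then have "\<C> \<in> Pow ?K \<longleftrightarrow> (\<forall>c \<in> \<C>. inj_on fst (cycle_vertices c))"
        by blast
      moreover note leg_partition_iff[of \<C> cycle_vertices I] weeks[of \<C>]
      ultimately show ?thesis
        using True cycle_vertices_subset by (smt (verit, best) PowD)
    qed auto
  qed
  \<comment> \<open>The bijection between cycles and routes lifts to collections; the remaining conditions on \<open>\<C>\<close> are
    those on its image, as \<open>cycle_leg_seq\<close> preserves leg sets and weeks are indexed injectively.\<close>
  have "bij_betw (\<lambda>\<C>. cycle_leg_seq ` \<C>)
      {\<C> \<in> Pow ?K. ?cover \<C> \<and> ?weeks \<C>} {S \<in> Pow ?R. ?partition S}"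
  proof (rule bij_betw_Collect[OF bij_betw_Pow[OF bij]])
    fix \<C> assume "\<C> \<in> Pow ?K"
    then have inj: "inj_on cycle_leg_seq \<C>"
      using bij by (auto simp: bij_betw_def intro: inj_on_subset)
    have "disjoint_family_on route_legs (cycle_leg_seq ` \<C>) \<longleftrightarrow>
        disjoint_family_on (\<lambda>c. fst ` cycle_vertices c) \<C>"
      using inj by (auto simp: disjoint_family_on_def route_legs_cycle_leg_seq inj_on_eq_iff)
    moreover have "(\<Union>r \<in> cycle_leg_seq ` \<C>. route_legs r) = (\<Union>c \<in> \<C>. fst ` cycle_vertices c)"
      by (simp add: route_legs_cycle_leg_seq)
    moreover have "(\<Sum>r \<in> cycle_leg_seq ` \<C>. route_weeks r) =
        (\<Sum>c \<in> \<C>. route_weeks (cycle_leg_seq c))"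
      using inj by (simp add: sum.reindex)
    ultimately show "?partition (cycle_leg_seq ` \<C>) \<longleftrightarrow> ?cover \<C> \<and> ?weeks \<C>"
      by simp
  qed
  also have "{S \<in> Pow ?R. ?partition S} = {S. feasible_solution I S}"
    by (auto simp: feasible_solution_def)
  finally show ?thesis
    unfolding L .
qed

end
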